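(* Let $S$ be a nonempty (possibly infinite) set of positive integers, and let $n\ge 1$ and $k\ge 0$ be integers. Then $$ \begin{bmatrix}n \\k \end{bmatrix}_S \frac{1}{n!} = \sum_{\substack{ \pi \in \mathcal{C}_n \\ \pi_i \in S \text{ for all } i \\ |\pi|=k }} \frac{1}{\vert \pi \vert! \prod_{i=1}^{|\pi|}{\pi_i}},\qquad \begin{Bmatrix}n \\k \end{Bmatrix}_S \frac{1}{n!} = \sum_{\substack{ \pi \in \mathcal{C}_n \\ \pi_i \in S \text{ for all } i \\ |\pi|=k}} \frac{1}{\vert \pi \vert!\, \pi!},$$ $$\frac{A_{n,S}}{n!} = \sum_{\substack{ \pi \in \mathcal{C}_n \\ \pi_i \in S \text{ for all } i }} \frac{1}{\vert \pi \vert! \prod_{i=1}^{|\pi|}{\pi_i}},\qquad \frac{B_{n,S}}{n!} = \sum_{\substack{ \pi \in \mathcal{C}_n \\ \pi_i \in S \text{ for all } i }} \frac{1}{\vert \pi \vert!\, \pi!}.$$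
   Context: For a set $S$ of positive integers and integers $n,k\ge 0$: - $\begin{bmatrix}n\\k\end{bmatrix}_S$ is the number of permutations of $n$ labeled elements having exactly $k$ cycles, each cycle having a length (fixed points being cycles of length 1) belonging to $S$. - $\begin{Bmatrix}n\\k\end{Bmatrix}_S$ is the number of set partitions of an $n$-element set into exactly $k$ (nonempty, unlabeled) blocks, each block having size belonging to $S$. - $A_{n,S}$ is the number of permutations of $n$ labeled elements all of whose cycle lengths belong to $S$; $B_{n,S}$ is the number of set partitions of an $n$-element set all of whose block sizes belong to $S$. $\mathcal{C}_n$ is the set of compositions of $n$, i.e. ordered tuples $\pi=(\pi_1,\ldots,\pi_m)$ of positive integers (parts) with $\pi_1+\cdots+\pi_m=n$. $|\pi|=m$ is the number of parts, and $\pi! = \prod_{i=1}^{m}\pi_i!$. *)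

theory Defs
  imports Complex_Main "HOL-Library.Disjoint_Sets" "HOL-Combinatorics.Orbits"
begin

(* Only the lengths of cycles and their number matter, so a cycle is represented by its
   underlying set; a fixed point x contributes the singleton orbit {x}. *)
definition cycle_sets :: "'a set \<Rightarrow> ('a \<Rightarrow> 'a) \<Rightarrow> 'a set set" where
  "cycle_sets A p = orbit p ` A"

definition S_permutations :: "nat set \<Rightarrow> nat \<Rightarrow> (nat \<Rightarrow> nat) set" where
  "S_permutations S n =
    {p. p permutes {1..n} \<and> (\<forall>c \<in> cycle_sets {1..n} p. card c \<in> S)}"

definition S_partitions :: "nat set \<Rightarrow> nat \<Rightarrow> nat set set set" where
  "S_partitions S n = {P. partition_on {1..n} P \<and> (\<forall>b \<in> P. card b \<in> S)}"

definition S_stirling1 :: "nat set \<Rightarrow> nat \<Rightarrow> nat \<Rightarrow> nat" where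
  "S_stirling1 S n k = card {p \<in> S_permutations S n. card (cycle_sets {1..n} p) = k}"

definition S_stirling2 :: "nat set \<Rightarrow> nat \<Rightarrow> nat \<Rightarrow> nat" where
  "S_stirling2 S n k = card {P \<in> S_partitions S n. card P = k}"

definition S_perm_count :: "nat set \<Rightarrow> nat \<Rightarrow> nat" where
  "S_perm_count S n = card (S_permutations S n)"

definition S_part_count :: "nat set \<Rightarrow> nat \<Rightarrow> nat" where
  "S_part_count S n = card (S_partitions S n)"

definition compositions :: "nat \<Rightarrow> nat list set" where
  "compositions n = {xs. (\<forall>x \<in> set xs. 0 < x) \<and> sum_list xs = n}"

lemma length_le_sum_list:
  fixes xs :: "nat list"
  shows "\<forall>x \<in> set xs. 0 < x \<Longrightarrow> length xs \<le> sum_list xs"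
  by (induction xs) auto

(* Sums over compositions are thus genuine finite sums. *)
lemma finite_compositions: "finite (compositions n)"
proof (rule finite_subset)
  show "compositions n \<subseteq> {xs. set xs \<subseteq> {..n} \<and> length xs \<le> n}"
    using length_le_sum_list member_le_sum_list
    by (fastforce simp: compositions_def)
  show "finite {xs. set xs \<subseteq> {..n} \<and> length xs \<le> n}"
    by (rule finite_lists_length_le) simp
qed

definition comp_fact :: "nat list \<Rightarrow> nat" where
  "comp_fact xs = (\<Prod>x\<leftarrow>xs. fact x)"

end

theory Submission
  imports Defs
begin

text \<open>Distinguishing one block (or cycle) \<open>b\<close> of a structure with \<open>k + 1\<close> blocks and removing it
  gives \<open>(k + 1) G(A, k + 1) = \<Sum>b\<subseteq>A. w |b| G(A - b, k)\<close>, where \<open>w j\<close> is \<open>1\<close> for set partitions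
  and \<open>(j - 1)!\<close> for permutations.  After division by \<open>|A|! (k + 1)!\<close> this is the recurrence that
  the sum over compositions with \<open>k + 1\<close> parts satisfies when its first part is split off.\<close>

section \<open>Weighted sums over compositions\<close>

abbreviation (input) S_compositions :: "nat set \<Rightarrow> nat \<Rightarrow> nat \<Rightarrow> nat list set" where
  "S_compositions S n k \<equiv> {xs. xs \<in> compositions n \<and> set xs \<subseteq> S \<and> length xs = k}"

text \<open>Grouping the subsets by size brings in the binomial coefficients: size \<open>j\<close>
  occurs \<open>card A choose j\<close> times.\<close>

lemma sum_subsets_by_card:
  fixes f :: "nat \<Rightarrow> real"
  assumes "finite A"
  shows "(\<Sum>b | b \<subseteq> A \<and> card b \<in> S. f (card b))
       = (\<Sum>j \<in> S \<inter> {..card A}. real (card A choose j) * f j)"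
proof -
  have "(\<Sum>b | b \<subseteq> A \<and> card b \<in> S. f (card b))
      = (\<Sum>j \<in> S \<inter> {..card A}. \<Sum>b | b \<in> {b. b \<subseteq> A \<and> card b \<in> S} \<and> card b = j. f (card b))"
    using assms by (intro sum.group [symmetric]) (auto intro: card_mono)
  also have "\<dots> = (\<Sum>j \<in> S \<inter> {..card A}. real (card A choose j) * f j)"
  proof (rule sum.cong [OF refl])
    fix j assume j: "j \<in> S \<inter> {..card A}"
    then have "{b \<in> {b. b \<subseteq> A \<and> card b \<in> S}. card b = j} = {b. b \<subseteq> A \<and> card b = j}"
      by auto
    then show "(\<Sum>b | b \<in> {b. b \<subseteq> A \<and> card b \<in> S} \<and> card b = j. f (card b))
             = real (card A choose j) * f j"
      using n_subsets [OF assms, of j] by simp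
  qed
  finally show ?thesis .
qed

lemma S_compositions_0: "S_compositions S n 0 = (if n = 0 then {[]} else {})"
  by (auto simp: compositions_def)

text \<open>A nonempty list is its head \<open>j\<close> followed by its tail. The condition
  \<open>0 \<notin> S\<close> keeps the parts positive when \<open>j\<close> is prepended, and
  \<open>j \<le> n\<close> makes \<open>n - j\<close> a true difference.\<close>

lemma sum_S_compositions_Suc:
  fixes v :: "nat \<Rightarrow> real"
  assumes "0 \<notin> S"
  shows "(\<Sum>xs \<in> S_compositions S n (Suc k). \<Prod>x\<leftarrow>xs. v x)
       = (\<Sum>j \<in> S \<inter> {..n}. v j * (\<Sum>xs \<in> S_compositions S (n - j) k. \<Prod>x\<leftarrow>xs. v x))"
proof -
  have fin: "finite (S_compositions S m l)" for m l
    by (rule finite_subset [OF _ finite_compositions [of m]]) auto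
  let ?T = "SIGMA j:S \<inter> {..n}. S_compositions S (n - j) k"
  have "bij_betw (\<lambda>(j, xs). j # xs) ?T (S_compositions S n (Suc k))"
    unfolding bij_betw_def
  proof
    show "inj_on (\<lambda>(j, xs). j # xs) ?T"
      by (auto simp: inj_on_def)
    show "(\<lambda>(j, xs). j # xs) ` ?T = S_compositions S n (Suc k)"
    proof (intro equalityI subsetI)
      fix ys assume "ys \<in> S_compositions S n (Suc k)"
      then obtain j xs where "ys = j # xs" "(j, xs) \<in> ?T"
        by (cases ys) (auto simp: compositions_def)
      then show "ys \<in> (\<lambda>(j, xs). j # xs) ` ?T"
        by force
    next
      fix ys assume "ys \<in> (\<lambda>(j, xs). j # xs) ` ?T"
      then show "ys \<in> S_compositions S n (Suc k)"
        using assms by (auto simp: compositions_def intro: gr0I)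
    qed
  qed
  then have "(\<Sum>xs \<in> S_compositions S n (Suc k). \<Prod>x\<leftarrow>xs. v x)
           = (\<Sum>(j, xs) \<in> ?T. v j * (\<Prod>x\<leftarrow>xs. v x))"
    by (subst sum.reindex_bij_betw [symmetric]) (auto simp: case_prod_unfold)
  also have "\<dots> = (\<Sum>j \<in> S \<inter> {..n}. \<Sum>xs \<in> S_compositions S (n - j) k. v j * (\<Prod>x\<leftarrow>xs. v x))"
    by (subst sum.Sigma) (use fin in auto)
  finally show ?thesis
    by (simp add: sum_distrib_left)
qed

text \<open>The right-hand side is the coefficient of x^n, n = |A|, in F(x)^k / k!, where F(x) is
  the sum of w(j) x^j / j! over j in S. The induction keeps \<open>A\<close> arbitrary because the
  recurrence passes from \<open>A\<close> to \<open>A - b\<close>.\<close>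

lemma exponential_formula:
  fixes G :: "'a set \<Rightarrow> nat \<Rightarrow> real" and w :: "nat \<Rightarrow> real"
  assumes "0 \<notin> S"
    and G_0: "\<And>A. finite A \<Longrightarrow> G A 0 = (if A = {} then 1 else 0)"
    and G_Suc: "\<And>A k. finite A \<Longrightarrow>
          real (Suc k) * G A (Suc k) = (\<Sum>b | b \<subseteq> A \<and> card b \<in> S. w (card b) * G (A - b) k)"
    and "finite A"
  shows "G A k / fact (card A)
       = (\<Sum>xs \<in> S_compositions S (card A) k. \<Prod>x\<leftarrow>xs. w x / fact x) / fact k"
  using \<open>finite A\<close>
proof (induction k arbitrary: A)
  case 0
  then show ?case
    unfolding S_compositions_0 by (simp add: G_0)
next
  case (Suc k)
  define C where "C m = (\<Sum>xs \<in> S_compositions S m k. \<Prod>x\<leftarrow>xs. w x / fact x)" for m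
  let ?n = "card A"
  have "real (Suc k) * G A (Suc k) = (\<Sum>b | b \<subseteq> A \<and> card b \<in> S. w (card b) * G (A - b) k)"
    by (rule G_Suc [OF Suc.prems])
  also have "\<dots> = (\<Sum>b | b \<subseteq> A \<and> card b \<in> S.
                    w (card b) * (fact (?n - card b) * C (?n - card b) / fact k))"
  proof (rule sum.cong [OF refl], clarify)
    fix b assume b: "b \<subseteq> A"
    have "G (A - b) k / fact (card (A - b)) = C (card (A - b)) / fact k"
      unfolding C_def using Suc.prems by (intro Suc.IH) auto
    moreover have "card (A - b) = ?n - card b"
      using b Suc.prems by (meson card_Diff_subset finite_subset)
    ultimately have "G (A - b) k = fact (?n - card b) * C (?n - card b) / fact k"
      by (simp add: field_simps)
    then show "w (card b) * G (A - b) k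
             = w (card b) * (fact (?n - card b) * C (?n - card b) / fact k)"
      by simp
  qed
  also have "\<dots> = (\<Sum>j \<in> S \<inter> {..?n}. real (?n choose j) * (w j * (fact (?n - j) * C (?n - j) / fact k)))"
    by (rule sum_subsets_by_card [OF Suc.prems])
  \<comment> \<open>Since (n choose j) (n - j)! = n! / j!, the factorial from the induction
    hypothesis cancels and the first part keeps the weight w(j) / j!.\<close>
  also have "\<dots> = (\<Sum>j \<in> S \<inter> {..?n}. fact ?n / fact k * (w j / fact j * C (?n - j)))"
  proof (rule sum.cong [OF refl])
    fix j assume "j \<in> S \<inter> {..?n}"
    then have "real (?n choose j) = fact ?n / (fact j * fact (?n - j))"
      by (simp add: binomial_fact)
    then show "real (?n choose j) * (w j * (fact (?n - j) * C (?n - j) / fact k))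
             = fact ?n / fact k * (w j / fact j * C (?n - j))"
      by simp
  qed
  also have "\<dots> = fact ?n / fact k * (\<Sum>xs \<in> S_compositions S ?n (Suc k). \<Prod>x\<leftarrow>xs. w x / fact x)"
    unfolding sum_S_compositions_Suc [OF \<open>0 \<notin> S\<close>] C_def by (simp add: sum_distrib_left)
  finally show ?case
    by (simp add: field_simps del: of_nat_Suc)
qed

text \<open>Double counting of the pairs of a structure \<open>x\<close> and one of its blocks
  \<open>b\<close>. Leaving \<open>blocks\<close> abstract serves both partitions, whose blocks are
  their elements, and permutations, whose blocks are their cycles.\<close>

lemma sum_card_blocks:
  assumes "finite X" and "finite A"
    and blocks: "\<And>x. x \<in> X \<Longrightarrow> blocks x \<subseteq> {b. b \<subseteq> A \<and> card b \<in> S} \<and> card (blocks x) = m"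
  shows "m * card X = (\<Sum>b | b \<subseteq> A \<and> card b \<in> S. card {x \<in> X. b \<in> blocks x})"
proof -
  let ?B = "{b. b \<subseteq> A \<and> card b \<in> S}"
  have "(\<Sum>x\<in>X. card {b \<in> ?B. b \<in> blocks x}) = (\<Sum>b\<in>?B. card {x \<in> X. b \<in> blocks x})"
    using assms(1,2) by (intro sum_multicount_gen) auto
  moreover have "card {b \<in> ?B. b \<in> blocks x} = m" if "x \<in> X" for x
  proof -
    have "{b \<in> ?B. b \<in> blocks x} = blocks x"
      using blocks [OF that] by blast
    then show ?thesis
      using blocks [OF that] by simp
  qed
  ultimately show ?thesis
    by (simp add: mult.commute)
qed

section \<open>Set partitions\<close>

text \<open>The ground set is arbitrary, since deleting a block from \<open>{1..n}\<close> need not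
  leave an initial segment.\<close>

definition partitions_into :: "nat set \<Rightarrow> 'a set \<Rightarrow> nat \<Rightarrow> 'a set set set" where
  "partitions_into S A k = {P. partition_on A P \<and> (\<forall>b\<in>P. card b \<in> S) \<and> card P = k}"

lemma finite_partitions_into: "finite A \<Longrightarrow> finite (partitions_into S A k)"
  by (rule finite_subset [OF _ finitely_many_partition_on]) (auto simp: partitions_into_def)

lemma partitions_into_0:
  assumes "finite A"
  shows "partitions_into S A 0 = (if A = {} then {{}} else {})"
proof -
  have "P \<in> partitions_into S A 0 \<longleftrightarrow> A = {} \<and> P = {}" for P
    using finite_elements [OF assms, of P]
    by (auto simp: partitions_into_def partition_on_def)
  then show ?thesis by auto
qed

lemma card_partitions_into_with_block:
  assumes "finite A" "b \<subseteq> A" "b \<noteq> {}" "card b \<in> S"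
  shows "card {P \<in> partitions_into S A (Suc k). b \<in> P} = card (partitions_into S (A - b) k)"
proof (rule bij_betw_same_card [symmetric], rule bij_betwI [where g = "\<lambda>P. P - {b}"])
  \<comment> \<open>The nonempty set \<open>b\<close> cannot occur in a partition of
    \<open>A - b\<close>, so inserting it adds exactly one block and deleting it restores the
    partition.\<close>
  have ins: "b \<notin> P \<and> disjnt b (\<Union>P) \<and> finite P" if "P \<in> partitions_into S (A - b) k" for P
    using that assms finite_elements [of "A - b" P]
    by (auto simp: partitions_into_def partition_on_def disjnt_def)
  show "insert b \<in> partitions_into S (A - b) k \<rightarrow> {P \<in> partitions_into S A (Suc k). b \<in> P}"
  proof
    fix P assume P: "P \<in> partitions_into S (A - b) k"
    then show "insert b P \<in> {P \<in> partitions_into S A (Suc k). b \<in> P}"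
      using ins [OF P] assms
      by (auto simp: partitions_into_def partition_on_insert)
  qed
  show "(\<lambda>P. P - {b}) \<in> {P \<in> partitions_into S A (Suc k). b \<in> P} \<rightarrow> partitions_into S (A - b) k"
  proof
    fix P assume P: "P \<in> {P \<in> partitions_into S A (Suc k). b \<in> P}"
    then have part: "partition_on A P" and bP: "insert b (P - {b}) = P"
      by (auto simp: partitions_into_def)
    have "disjnt b (\<Union>(P - {b}))"
      using part P by (force simp: partition_on_def disjoint_def disjnt_def)
    then have "partition_on (A - b) (P - {b})"
      using partition_on_insert [of b "P - {b}" A] part bP by simp
    then show "P - {b} \<in> partitions_into S (A - b) k"
      using P by (auto simp: partitions_into_def)
  qed
  show "insert b P - {b} = P" if "P \<in> partitions_into S (A - b) k" for P
    using ins [OF that] by auto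
qed auto

lemma card_partitions_into_Suc:
  assumes "finite A" "0 \<notin> S"
  shows "Suc k * card (partitions_into S A (Suc k))
       = (\<Sum>b | b \<subseteq> A \<and> card b \<in> S. card (partitions_into S (A - b) k))"
proof -
  have "Suc k * card (partitions_into S A (Suc k))
      = (\<Sum>b | b \<subseteq> A \<and> card b \<in> S. card {P \<in> partitions_into S A (Suc k). b \<in> P})"
    using assms by (intro sum_card_blocks finite_partitions_into)
      (auto simp: partitions_into_def partition_on_def)
  \<comment> \<open>Here \<open>0 \<notin> S\<close> forces every admissible \<open>b\<close> to be
    nonempty.\<close>
  also have "\<dots> = (\<Sum>b | b \<subseteq> A \<and> card b \<in> S. card (partitions_into S (A - b) k))"
    using assms by (intro sum.cong refl card_partitions_into_with_block) auto
  finally show ?thesis .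
qed

section \<open>Permutations\<close>

text \<open>Orbits of a permutation of a finite set are cyclic, and a cyclic set is by definition
  the orbit of one of its elements. This form no longer refers to a starting point.\<close>

lemma cycle_sets_iff:
  assumes "finite A" "p permutes A"
  shows "b \<in> cycle_sets A p \<longleftrightarrow> b \<subseteq> A \<and> cyclic_on p b"
proof
  assume "b \<in> cycle_sets A p"
  then show "b \<subseteq> A \<and> cyclic_on p b"
    using assms permutes_orbit_subset cyclic_on_orbit unfolding cycle_sets_def by fastforce
next
  assume "b \<subseteq> A \<and> cyclic_on p b"
  then show "b \<in> cycle_sets A p"
    unfolding cycle_sets_def cyclic_on_def by blast
qed

text \<open>\<open>q permutes b\<close> makes \<open>q\<close> the identity outside
  \<open>b\<close>, so each cyclic arrangement of \<open>b\<close> is counted once. The empty set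
  has none, as a cyclic set is the orbit of one of its elements.\<close>

definition cyclic_perms :: "'a set \<Rightarrow> ('a \<Rightarrow> 'a) set" where
  "cyclic_perms b = {q. q permutes b \<and> cyclic_on q b}"

section \<open>Splitting off a cycle\<close>

lemma comp_disjoint_permutes:
  assumes "q permutes b" "r permutes A - b"
  shows "x \<in> b \<Longrightarrow> (q \<circ> r) x = q x" and "x \<notin> b \<Longrightarrow> (q \<circ> r) x = r x"
proof -
  show "(q \<circ> r) x = q x" if "x \<in> b"
    using that permutes_not_in [OF assms(2), of x] by simp
  show "(q \<circ> r) x = r x" if "x \<notin> b"
  proof -
    \<comment> \<open>Either \<open>r\<close> fixes \<open>x\<close>, or \<open>x\<close> lies in
      \<open>A - b\<close> and \<open>r\<close> keeps it there.\<close>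
    have "r x \<notin> b"
      using that permutes_in_image [OF assms(2), of x] permutes_not_in [OF assms(2), of x] by auto
    then show ?thesis
      using permutes_not_in [OF assms(1)] by simp
  qed
qed

text \<open>Both \<open>b\<close> and \<open>A - b\<close> are invariant under the composition,
  which agrees with \<open>q\<close> on the one and with \<open>r\<close> on the other; orbits
  depend only on the values inside an invariant set.\<close>

lemma cycle_sets_comp:
  assumes "b \<subseteq> A" "q \<in> cyclic_perms b" "r permutes A - b"
  shows "cycle_sets A (q \<circ> r) = insert b (cycle_sets (A - b) r)"
proof -
  have q: "q permutes b" "cyclic_on q b"
    using assms(2) by (auto simp: cyclic_perms_def)
  note cmp = comp_disjoint_permutes [OF q(1) assms(3)]
  have "orbit (q \<circ> r) x = b" if "x \<in> b" for x
  proof -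
    have "cyclic_on (q \<circ> r) b"
      using q(2) cyclic_cong [of b "q \<circ> r" q] cmp(1) by blast
    then show ?thesis
      using that by (rule orbit_cyclic_eq3)
  qed
  moreover have "orbit (q \<circ> r) x = orbit r x" if "x \<in> A - b" for x
  proof (rule orbit_cong0 [OF that])
    show "q \<circ> r \<in> A - b \<rightarrow> A - b"
      using cmp(2) permutes_in_image [OF assms(3)] by auto
  qed (use cmp(2) in auto)
  moreover have "A = b \<union> (A - b)" "b \<noteq> {}"
    using assms(1) q(2) by (auto simp: cyclic_on_alldef)
  ultimately have "orbit (q \<circ> r) ` b = {b}" "orbit (q \<circ> r) ` (A - b) = orbit r ` (A - b)"
    by auto
  then show ?thesis
    unfolding cycle_sets_def using \<open>A = b \<union> (A - b)\<close> by (metis image_Un insert_is_Un)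
qed

text \<open>The factors move disjoint sets of points, so both can be read off from the composition:
  the inverse restricts \<open>p\<close> to \<open>b\<close> and to \<open>A - b\<close>, with
  \<open>perm_restrict\<close> acting as the identity elsewhere.\<close>

lemma bij_betw_split_cycle:
  assumes "finite A" "b \<subseteq> A"
  shows "bij_betw (\<lambda>(q, r). q \<circ> r) (cyclic_perms b \<times> {r. r permutes A - b})
           {p. p permutes A \<and> b \<in> cycle_sets A p}"
proof (rule bij_betwI [where g = "\<lambda>p. (perm_restrict p b, perm_restrict p (A - b))"])
  show "(\<lambda>(q, r). q \<circ> r) \<in> cyclic_perms b \<times> {r. r permutes A - b}
          \<rightarrow> {p. p permutes A \<and> b \<in> cycle_sets A p}"
  proof clarify
    fix q r assume q: "q \<in> cyclic_perms b" and r: "r permutes A - b"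
    have "q permutes A" "r permutes A"
      using q r assms(2) by (auto simp: cyclic_perms_def intro: permutes_subset)
    then show "q \<circ> r permutes A \<and> b \<in> cycle_sets A (q \<circ> r)"
      using cycle_sets_comp [OF assms(2) q r] permutes_compose by blast
  qed
  show "(\<lambda>p. (perm_restrict p b, perm_restrict p (A - b)))
          \<in> {p. p permutes A \<and> b \<in> cycle_sets A p} \<rightarrow> cyclic_perms b \<times> {r. r permutes A - b}"
  proof
    fix p assume "p \<in> {p. p permutes A \<and> b \<in> cycle_sets A p}"
    then have p: "p permutes A" and "b \<in> cycle_sets A p"
      by auto
    then have cyc: "cyclic_on p b"
      using cycle_sets_iff [OF assms(1) p] by blast
    have "perm_restrict p b permutes b"
    proof -
      have "inj_on p b"
        using permutes_inj_on [OF p] .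
      moreover have "p ` b \<subseteq> b"
        using cyclic_on_inI [OF cyc] by blast
      moreover have "finite b"
        using assms finite_subset by blast
      ultimately have "bij_betw p b b"
        by (simp add: bij_betw_def endo_inj_surj)
      then have "bij_betw (perm_restrict p b) b b"
        by (subst bij_betw_cong [of b _ p]) (auto simp: perm_restrict_def)
      then show ?thesis
        by (rule bij_imp_permutes) (simp add: perm_restrict_def)
    qed
    then have "perm_restrict p b \<in> cyclic_perms b"
      using cyc by (simp add: cyclic_perms_def cyclic_on_perm_restrict)
    then show "(perm_restrict p b, perm_restrict p (A - b))
                 \<in> cyclic_perms b \<times> {r. r permutes A - b}"
      using perm_restrict_diff_cyclic [OF p cyc] by simp
  qed
  show "(\<lambda>p. (perm_restrict p b, perm_restrict p (A - b))) ((\<lambda>(q, r). q \<circ> r) y) = y"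
    if y: "y \<in> cyclic_perms b \<times> {r. r permutes A - b}" for y
  proof -
    obtain q r where [simp]: "y = (q, r)" by fastforce
    have q: "q permutes b" and r: "r permutes A - b"
      using y by (auto simp: cyclic_perms_def)
    have "perm_restrict (q \<circ> r) b = q" "perm_restrict (q \<circ> r) (A - b) = r"
      using comp_disjoint_permutes [OF q r] permutes_not_in [OF q] permutes_not_in [OF r]
      by (auto simp: perm_restrict_def fun_eq_iff simp del: o_apply)
    then show ?thesis by simp
  qed
  show "(\<lambda>(q, r). q \<circ> r) (perm_restrict p b, perm_restrict p (A - b)) = p"
    if "p \<in> {p. p permutes A \<and> b \<in> cycle_sets A p}" for p
  proof -
    have p: "p permutes A" and cyc: "cyclic_on p b"
      using that cycle_sets_iff [OF assms(1), of p b] by auto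
    have "perm_restrict p (A - b) \<circ> perm_restrict p b = perm_restrict p ((A - b) \<union> b)"
      by (rule perm_restrict_comp) (use cyc in auto)
    \<comment> \<open>The factors commute because \<open>p\<close> preserves both \<open>b\<close>
      and its complement; this puts them in the required order.\<close>
    moreover have "perm_restrict p b \<circ> perm_restrict p (A - b)
                 = perm_restrict p (A - b) \<circ> perm_restrict p b"
    proof
      fix x
      have "p x \<in> b \<longleftrightarrow> x \<in> b"
        using cyclic_on_inI [OF cyc] cyclic_on_f_in [OF p cyc] by blast
      then show "(perm_restrict p b \<circ> perm_restrict p (A - b)) x
               = (perm_restrict p (A - b) \<circ> perm_restrict p b) x"
        by (simp add: perm_restrict_def)
    qed
    ultimately show ?thesis
      using p assms(2) by (simp add: Un_absorb2)
  qed
qed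

text \<open>Count all permutations of \<open>A\<close> by the cycle through a fixed element \<open>a\<close>: by induction the
  cycles of each size \<open>j < |A|\<close> account for \<open>(|A| - 1)!\<close> permutations, which leaves
  \<open>|A|! - (|A| - 1) (|A| - 1)! = (|A| - 1)!\<close> for \<open>j = |A|\<close>.\<close>

lemma card_cyclic_perms:
  assumes "finite b" "b \<noteq> {}"
  shows "card (cyclic_perms b) = fact (card b - 1)"
  using assms
proof (induction rule: finite_psubset_induct)
  case (psubset A)
  obtain a where a: "a \<in> A"
    using psubset.prems by blast
  define n where "n = card A - 1"
  have cardA: "card A = Suc n"
    using card_Suc_Diff1 [OF psubset.hyps a] a by (simp add: n_def)
  let ?B = "{b. b \<subseteq> A \<and> a \<in> b}"
  have fib: "card {p. p permutes A \<and> b \<in> cycle_sets A p} = card (cyclic_perms b) * fact (card A - card b)"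
    if "b \<subseteq> A" for b
  proof -
    have "card {p. p permutes A \<and> b \<in> cycle_sets A p}
        = card (cyclic_perms b) * card {r. r permutes A - b}"
      using bij_betw_same_card [OF bij_betw_split_cycle [OF psubset.hyps that]]
      by (simp add: card_cartesian_product)
    then show ?thesis
      using card_permutations [of "A - b" "card A - card b"] psubset.hyps that
      by (simp add: card_Diff_subset finite_subset)
  qed
  \<comment> \<open>Since \<open>a \<in> b\<close>, having \<open>b\<close> as a cycle means that
    \<open>b\<close> is the cycle through \<open>a\<close>. Every permutation is thus counted for
    exactly one \<open>b\<close>.\<close>
  have unique: "{p \<in> {p. p permutes A}. orbit p a = b} = {p. p permutes A \<and> b \<in> cycle_sets A p}"
    if "b \<in> ?B" for b
  proof -
    have "orbit p a = b \<longleftrightarrow> b \<in> cycle_sets A p" if "p permutes A" for p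
      using \<open>b \<in> ?B\<close> a cycle_sets_iff [OF psubset.hyps that, of b] orbit_cyclic_eq3 [of p b a]
      by (metis (no_types, lifting) cycle_sets_def imageI mem_Collect_eq)
    then show ?thesis
      by blast
  qed
  have orbit_a: "orbit p a \<in> ?B" if "p permutes A" for p
    using permutation_self_in_orbit [OF permutes_imp_permutation [OF psubset.hyps that]]
      permutes_orbit_subset [OF that a] by simp
  have "fact (Suc n) = card {p. p permutes A}"
    using card_permutations [OF cardA psubset.hyps] by simp
  also have "\<dots> = (\<Sum>b\<in>?B. card {p \<in> {p. p permutes A}. orbit p a = b})"
  proof -
    have "(\<Sum>b\<in>?B. \<Sum>p | p \<in> {p. p permutes A} \<and> orbit p a = b. 1) = (\<Sum>p | p permutes A. 1::nat)"
      using psubset.hyps orbit_a by (intro sum.group finite_permutations) auto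
    then show ?thesis by simp
  qed
  also have "\<dots> = (\<Sum>b\<in>?B. card (cyclic_perms b) * fact (card A - card b))"
  proof (rule sum.cong [OF refl])
    fix b assume "b \<in> ?B"
    then show "card {p \<in> {p. p permutes A}. orbit p a = b} = card (cyclic_perms b) * fact (card A - card b)"
      using fib [of b] by (subst unique) simp_all
  qed
  \<comment> \<open>The induction hypothesis covers only proper subsets, so \<open>b = A\<close> is
    split off; its second factor is 0! = 1.\<close>
  also have "\<dots> = card (cyclic_perms A) +
      (\<Sum>b\<in>?B - {A}. card (cyclic_perms b) * fact (card A - card b))"
    using a psubset.hyps sum.remove [of ?B A "\<lambda>b. card (cyclic_perms b) * fact (card A - card b)"]
    by simp
  also have "(\<Sum>b\<in>?B - {A}. card (cyclic_perms b) * fact (card A - card b))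
           = (\<Sum>b\<in>?B - {A}. fact (card b - 1) * fact (card A - card b))"
  proof (rule sum.cong [OF refl])
    fix b assume "b \<in> ?B - {A}"
    then have "b \<subset> A" "b \<noteq> {}"
      by auto
    then show "card (cyclic_perms b) * fact (card A - card b) = fact (card b - 1) * fact (card A - card b)"
      by (simp add: psubset.IH)
  qed
  finally have total: "fact (Suc n) = card (cyclic_perms A) +
      (\<Sum>b\<in>?B - {A}. fact (card b - 1) * fact (card A - card b))" .
  \<comment> \<open>The same sum with the expected value also at \<open>b = A\<close> is evaluated
    independently; comparison with \<open>total\<close> then leaves n! for
    \<open>card (cyclic_perms A)\<close>.\<close>
  have "(\<Sum>b\<in>?B. fact (card b - 1) * fact (card A - card b)) = (fact (Suc n) :: nat)"
  proof -
    have "bij_betw (insert a) (Pow (A - {a})) ?B"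
      by (rule bij_betwI [where g = "\<lambda>b. b - {a}"]) (use a in auto)
    then have "(\<Sum>b\<in>?B. fact (card b - 1) * fact (card A - card b))
             = (\<Sum>c\<in>Pow (A - {a}). fact (card (insert a c) - 1) * fact (card A - card (insert a c)) :: nat)"
      by (simp add: sum.reindex_bij_betw [symmetric])
    also have "\<dots> = (\<Sum>c\<in>Pow (A - {a}). fact (card c) * fact (n - card c))"
    proof (rule sum.cong [OF refl])
      fix c assume "c \<in> Pow (A - {a})"
      then have "card (insert a c) = Suc (card c)"
        using psubset.hyps finite_subset [of c A] by (subst card_insert_disjoint) auto
      then show "fact (card (insert a c) - 1) * fact (card A - card (insert a c))
               = (fact (card c) * fact (n - card c) :: nat)"
        using cardA by simp
    qed
    also have "real \<dots> = (\<Sum>b | b \<subseteq> A - {a} \<and> card b \<in> UNIV. fact (card b) * fact (n - card b))"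
      by (simp add: Pow_def)
    \<comment> \<open>Each of the n + 1 sizes contributes (n choose j) j! (n - j)! = n!.\<close>
    also have "\<dots> = (\<Sum>j\<le>n. real (n choose j) * (fact j * fact (n - j)))"
      using sum_subsets_by_card [of "A - {a}" "\<lambda>j. fact j * fact (n - j)" UNIV] psubset.hyps a cardA
      by simp
    also have "\<dots> = (\<Sum>j\<le>n. fact n)"
      by (rule sum.cong [OF refl]) (simp add: binomial_fact)
    also have "\<dots> = real (fact (Suc n))"
      by (simp add: algebra_simps)
    finally show ?thesis
      by (simp only: of_nat_eq_iff)
  qed
  moreover have "(\<Sum>b\<in>?B. fact (card b - 1) * fact (card A - card b)) = fact n +
      (\<Sum>b\<in>?B - {A}. fact (card b - 1) * fact (card A - card b) :: nat)"
    using a psubset.hyps cardA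
      sum.remove [of ?B A "\<lambda>b. fact (card b - 1) * fact (card A - card b) :: nat"]
    by simp
  ultimately show ?case
    using total by (simp add: n_def)
qed

section \<open>Permutations by number of cycles\<close>

definition perms_with_cycles :: "nat set \<Rightarrow> 'a set \<Rightarrow> nat \<Rightarrow> ('a \<Rightarrow> 'a) set" where
  "perms_with_cycles S A k =
    {p. p permutes A \<and> (\<forall>c \<in> cycle_sets A p. card c \<in> S) \<and> card (cycle_sets A p) = k}"

lemma finite_perms_with_cycles: "finite A \<Longrightarrow> finite (perms_with_cycles S A k)"
  by (rule finite_subset [OF _ finite_permutations [of A]]) (auto simp: perms_with_cycles_def)

lemma perms_with_cycles_0:
  assumes "finite A"
  shows "perms_with_cycles S A 0 = (if A = {} then {id} else {})"
  using assms by (auto simp: perms_with_cycles_def cycle_sets_def)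

text \<open>The cycles of \<open>q \<circ> r\<close> are \<open>b\<close> and those of
  \<open>r\<close>, so the conditions on the composition become conditions on \<open>r\<close>
  alone, while \<open>q\<close> ranges over all (|b| - 1)! cycles on \<open>b\<close>.\<close>

lemma card_perms_with_given_cycle:
  assumes "finite A" "b \<subseteq> A" "b \<noteq> {}" "card b \<in> S"
  shows "card {p \<in> perms_with_cycles S A (Suc k). b \<in> cycle_sets A p}
       = fact (card b - 1) * card (perms_with_cycles S (A - b) k)"
proof -
  let ?f = "\<lambda>(q, r). q \<circ> r :: 'a \<Rightarrow> 'a"
  let ?D = "cyclic_perms b \<times> {r. r permutes A - b}"
  let ?R = "{p. p permutes A \<and> b \<in> cycle_sets A p}"
  note bij = bij_betw_split_cycle [OF assms(1,2)]
  have iff: "q \<circ> r \<in> perms_with_cycles S A (Suc k) \<longleftrightarrow> r \<in> perms_with_cycles S (A - b) k"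
    if "q \<in> cyclic_perms b" "r permutes A - b" for q r
  proof -
    have "q \<circ> r permutes A"
      using bij_betwE [OF bij] that by auto
    \<comment> \<open>The cycles of \<open>r\<close> lie inside \<open>A - b\<close>, so the
      nonempty \<open>b\<close> is not among them and the number of cycles rises by exactly
      one.\<close>
    moreover have "b \<notin> cycle_sets (A - b) r"
      using cycle_sets_iff [of "A - b" r b] that(2) assms(1,3) by auto
    moreover have "finite (cycle_sets (A - b) r)"
      using assms(1) by (simp add: cycle_sets_def)
    ultimately show ?thesis
      using that(2) assms(4) cycle_sets_comp [OF assms(2) that] by (simp add: perms_with_cycles_def)
  qed
  have "?f ` (cyclic_perms b \<times> perms_with_cycles S (A - b) k)
      = {p \<in> perms_with_cycles S A (Suc k). b \<in> cycle_sets A p}" (is "?f ` ?E = ?F")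
  proof (intro equalityI subsetI)
    fix p assume "p \<in> ?f ` ?E"
    then obtain q r where "p = q \<circ> r" "q \<in> cyclic_perms b" "r \<in> perms_with_cycles S (A - b) k"
      by auto
    moreover from this have "r permutes A - b"
      by (simp add: perms_with_cycles_def)
    ultimately show "p \<in> ?F"
      using iff [of q r] bij_betwE [OF bij] by auto
  next
    fix p assume p: "p \<in> ?F"
    then have "p \<in> ?f ` ?D"
      using bij_betw_imp_surj_on [OF bij] by (simp add: perms_with_cycles_def)
    then obtain q r where "p = q \<circ> r" "q \<in> cyclic_perms b" "r permutes A - b"
      by auto
    then show "p \<in> ?f ` ?E"
      using iff [of q r] p by force
  qed
  moreover have "inj_on ?f ?E"
    by (rule inj_on_subset [OF bij_betw_imp_inj_on [OF bij]]) (auto simp: perms_with_cycles_def)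
  then have "card (?f ` ?E) = card ?E"
    by (rule card_image)
  moreover have "finite b"
    using assms(1,2) finite_subset by blast
  ultimately show ?thesis
    using card_cyclic_perms [of b] assms(3) by (simp add: card_cartesian_product)
qed

lemma card_perms_with_cycles_Suc:
  assumes "finite A" "0 \<notin> S"
  shows "Suc k * card (perms_with_cycles S A (Suc k))
       = (\<Sum>b | b \<subseteq> A \<and> card b \<in> S. fact (card b - 1) * card (perms_with_cycles S (A - b) k))"
proof -
  have "Suc k * card (perms_with_cycles S A (Suc k))
      = (\<Sum>b | b \<subseteq> A \<and> card b \<in> S. card {p \<in> perms_with_cycles S A (Suc k). b \<in> cycle_sets A p})"
    using assms by (intro sum_card_blocks finite_perms_with_cycles)
      (auto simp: perms_with_cycles_def cycle_sets_iff)
  also have "\<dots> = (\<Sum>b | b \<subseteq> A \<and> card b \<in> S.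
                    fact (card b - 1) * card (perms_with_cycles S (A - b) k))"
    using assms by (intro sum.cong refl card_perms_with_given_cycle) auto
  finally show ?thesis .
qed

section \<open>The four identities\<close>

text \<open>The weight of a component is (j - 1)!, the number of cycles on j points, and (j - 1)! /
  j! = 1 / j.\<close>

lemma stirling1_formula:
  assumes "0 \<notin> S"
  shows "real (S_stirling1 S n k) / fact n =
           (\<Sum>xs \<in> S_compositions S n k. 1 / (fact (length xs) * real (prod_list xs)))"
proof -
  have "S_stirling1 S n k = card (perms_with_cycles S {1..n} k)"
    by (simp add: S_stirling1_def S_permutations_def perms_with_cycles_def conj_assoc)
  moreover have "real (card (perms_with_cycles S {1..n} k)) / fact (card {1..n})
      = (\<Sum>xs \<in> S_compositions S (card {1..n}) k. \<Prod>x\<leftarrow>xs. fact (x - 1) / fact x) / fact k"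
  proof (rule exponential_formula)
    fix A :: "nat set" and k assume "finite A"
    show "real (Suc k) * real (card (perms_with_cycles S A (Suc k)))
      = (\<Sum>b | b \<subseteq> A \<and> card b \<in> S. fact (card b - 1) * real (card (perms_with_cycles S (A - b) k)))"
      using arg_cong [OF card_perms_with_cycles_Suc [OF \<open>finite A\<close> assms, of k], of real]
      unfolding of_nat_mult of_nat_sum of_nat_fact .
  qed (use assms in \<open>auto simp: perms_with_cycles_0\<close>)
  \<comment> \<open>Positivity of the parts matters: at \<open>x = 0\<close> truncated subtraction
    would make the factor 1, whereas \<open>1 / real 0\<close> is 0.\<close>
  moreover have "(\<Prod>x\<leftarrow>xs. fact (x - 1) / fact x) = 1 / real (prod_list xs)" if "set xs \<subseteq> S" for xs
    using that
  proof (induction xs)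
    case (Cons x xs)
    then have "x > 0"
      using assms by (auto intro: gr0I)
    then have "fact (x - 1) / fact x = 1 / real x"
      by (simp add: fact_reduce)
    then show ?case
      using Cons by simp
  qed simp
  ultimately show ?thesis
    by (simp add: sum_divide_distrib mult.commute)
qed

text \<open>A block carries no structure, so its weight is 1 and a part \<open>x\<close> contributes
  \<open>1 / fact x\<close>.\<close>

lemma stirling2_formula:
  assumes "0 \<notin> S"
  shows "real (S_stirling2 S n k) / fact n =
           (\<Sum>xs \<in> S_compositions S n k. 1 / (fact (length xs) * real (comp_fact xs)))"
proof -
  have "S_stirling2 S n k = card (partitions_into S {1..n} k)"
    by (simp add: S_stirling2_def S_partitions_def partitions_into_def conj_assoc)
  moreover have "real (card (partitions_into S {1..n} k)) / fact (card {1..n})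
      = (\<Sum>xs \<in> S_compositions S (card {1..n}) k. \<Prod>x\<leftarrow>xs. 1 / fact x) / fact k"
  proof (rule exponential_formula)
    fix A :: "nat set" and k assume "finite A"
    show "real (Suc k) * real (card (partitions_into S A (Suc k)))
      = (\<Sum>b | b \<subseteq> A \<and> card b \<in> S. 1 * real (card (partitions_into S (A - b) k)))"
      using arg_cong [OF card_partitions_into_Suc [OF \<open>finite A\<close> assms, of k], of real]
      unfolding of_nat_mult of_nat_sum mult_1 .
  qed (use assms in \<open>auto simp: partitions_into_0\<close>)
  moreover have "(\<Prod>x\<leftarrow>xs. 1 / fact x) = 1 / real (comp_fact xs)" for xs
    by (induction xs) (auto simp: comp_fact_def)
  ultimately show ?thesis
    by (simp add: sum_divide_distrib mult.commute)
qed

section \<open>From a fixed number of components to totals\<close>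

lemma S_perm_count_eq_sum: "S_perm_count S n = (\<Sum>k\<le>n. S_stirling1 S n k)"
proof -
  have "finite (S_permutations S n)"
    by (rule finite_subset [OF _ finite_permutations [of "{1..n}"]]) (auto simp: S_permutations_def)
  \<comment> \<open>The cycles are the images of n points under \<open>orbit p\<close>, so the
    cutoff at \<open>n\<close> loses nothing.\<close>
  moreover have "card (cycle_sets {1..n} p) \<le> n" for p
    using card_image_le [of "{1..n}" "orbit p"] by (simp add: cycle_sets_def)
  ultimately have "(\<Sum>k\<le>n. \<Sum>p | p \<in> S_permutations S n \<and> card (cycle_sets {1..n} p) = k. 1)
                 = (\<Sum>p \<in> S_permutations S n. 1::nat)"
    by (intro sum.group) auto
  then show ?thesis
    by (simp add: S_perm_count_def S_stirling1_def)
qed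

text \<open>Blocks are nonempty, so each contributes at least 1 to the sum of the block sizes, which
  is \<open>card A\<close>.\<close>

lemma card_partition_le:
  assumes "finite A" "partition_on A P"
  shows "card P \<le> card A"
proof -
  have fin: "finite b" if "b \<in> P" for b
    using that assms by (auto simp: partition_on_def intro: finite_subset)
  have "card P = (\<Sum>b\<in>P. 1)"
    by simp
  also have "\<dots> \<le> (\<Sum>b\<in>P. card b)"
    using fin assms(2) by (intro sum_mono) (auto simp: partition_on_def Suc_le_eq card_gt_0_iff)
  also have "\<dots> = card A"
    using product_partition [OF assms(2) fin] by simp
  finally show ?thesis .
qed

lemma S_part_count_eq_sum: "S_part_count S n = (\<Sum>k\<le>n. S_stirling2 S n k)"
proof -
  have "finite (S_partitions S n)"
    by (rule finite_subset [OF _ finitely_many_partition_on [of "{1..n}"]])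
      (auto simp: S_partitions_def)
  moreover have "card P \<le> n" if "P \<in> S_partitions S n" for P
    using card_partition_le [of "{1..n}" P] that by (simp add: S_partitions_def)
  ultimately have "(\<Sum>k\<le>n. \<Sum>P | P \<in> S_partitions S n \<and> card P = k. 1)
                 = (\<Sum>P \<in> S_partitions S n. 1::nat)"
    by (intro sum.group) auto
  then show ?thesis
    by (simp add: S_part_count_def S_stirling2_def)
qed

text \<open>Positive parts bound the length by \<open>n\<close>. The range \<open>k \<le> n\<close>
  is also the one used for the total counts, so the two sides can be compared term by term.\<close>

lemma sum_compositions_by_length:
  fixes g :: "nat list \<Rightarrow> real"
  shows "(\<Sum>xs | xs \<in> compositions n \<and> set xs \<subseteq> S. g xs) = (\<Sum>k\<le>n. \<Sum>xs \<in> S_compositions S n k. g xs)"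
proof -
  let ?X = "{xs. xs \<in> compositions n \<and> set xs \<subseteq> S}"
  have "finite ?X"
    by (rule finite_subset [OF _ finite_compositions [of n]]) auto
  then have "(\<Sum>k\<le>n. \<Sum>xs | xs \<in> ?X \<and> length xs = k. g xs) = (\<Sum>xs\<in>?X. g xs)"
    using length_le_sum_list by (intro sum.group) (auto simp: compositions_def)
  then show ?thesis
    by (simp add: conj_assoc)
qed

theorem theorem3:
  fixes S :: "nat set" and n k :: nat
  assumes "S \<noteq> {}" and "\<forall>s \<in> S. 0 < s" and "1 \<le> n"
  shows "real (S_stirling1 S n k) * (1 / fact n) =
           (\<Sum>xs | xs \<in> compositions n \<and> set xs \<subseteq> S \<and> length xs = k.
              1 / (fact (length xs) * real (prod_list xs)))
       \<and> real (S_stirling2 S n k) * (1 / fact n) =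
           (\<Sum>xs | xs \<in> compositions n \<and> set xs \<subseteq> S \<and> length xs = k.
              1 / (fact (length xs) * real (comp_fact xs)))
       \<and> real (S_perm_count S n) / fact n =
           (\<Sum>xs | xs \<in> compositions n \<and> set xs \<subseteq> S.
              1 / (fact (length xs) * real (prod_list xs)))
       \<and> real (S_part_count S n) / fact n =
           (\<Sum>xs | xs \<in> compositions n \<and> set xs \<subseteq> S.
              1 / (fact (length xs) * real (comp_fact xs)))"
proof -
  have S: "0 \<notin> S"
    using assms(2) by blast
  have "real (S_perm_count S n) / fact n = (\<Sum>k\<le>n. real (S_stirling1 S n k) / fact n)"
    by (simp add: S_perm_count_eq_sum sum_divide_distrib)
  moreover have "real (S_part_count S n) / fact n = (\<Sum>k\<le>n. real (S_stirling2 S n k) / fact n)"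
    by (simp add: S_part_count_eq_sum sum_divide_distrib)
  ultimately show ?thesis
    unfolding sum_compositions_by_length
    using stirling1_formula [OF S] stirling2_formula [OF S] by simp
qed

end
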